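(* Let $A,B$ be positive semidefinite $n\times n$ complex matrices, $X$ an $n\times n$ complex matrix and $N\in\mathbb{N}$ (with $N\ge 1$). If $0\leq\nu\leq\frac{1}{2}$, then \begin{align*} &\|A^{\nu}XB^{1-\nu}+A^{1-\nu}XB^{\nu}\|_2^2+2\nu\|AX-XB\|_2^2\\ &+\sum_{j=1}^{N}s_j(2\nu)\left\|A^{1-\frac{k_j(2\nu)}{2^j}}XB^{\frac{k_j(2\nu)}{2^j}}-A^{1-\frac{k_j(2\nu)+1}{2^j}}XB^{\frac{k_j(2\nu)+1}{2^j}}\right\|_2^2\\ &+\sum_{j=1}^{N}s_j(2\nu)\left\|A^{\frac{k_j(2\nu)}{2^j}}XB^{1-\frac{k_j(2\nu)}{2^j}}-A^{\frac{k_j(2\nu)+1}{2^j}}XB^{1-\frac{k_j(2\nu)+1}{2^j}}\right\|_2^2\leq\|AX+XB\|_2^2. \end{align*} If $\frac{1}{2}\leq\nu\leq 1$, then \begin{align*} &\|A^{\nu}XB^{1-\nu}+A^{1-\nu}XB^{\nu}\|_2^2+2(1-\nu)\|AX-XB\|_2^2\\ &+\sum_{j=1}^{N}s_j(2-2\nu)\left\|A^{1-\frac{k_j(2-2\nu)}{2^j}}XB^{\frac{k_j(2-2\nu)}{2^j}}-A^{1-\frac{k_j(2-2\nu)+1}{2^j}}XB^{\frac{k_j(2-2\nu)+1}{2^j}}\right\|_2^2\\ &+\sum_{j=1}^{N}s_j(2-2\nu)\left\|A^{\frac{k_j(2-2\nu)}{2^j}}XB^{1-\frac{k_j(2-2\nu)}{2^j}}-A^{\frac{k_j(2-2\nu)+1}{2^j}}XB^{1-\frac{k_j(2-2\nu)+1}{2^j}}\right\|_2^2\leq\|AX+XB\|_2^2.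 \end{align*}
   Context: $\|\cdot\|_2$ is the Hilbert-Schmidt (Frobenius) norm. $[x]$ denotes the greatest integer $\le x$. For $\nu\in[0,1]$ and $j\geq 1$ put $k_j(\nu)=[2^{j-1}\nu]$, $r_j(\nu)=[2^{j}\nu]$ and $s_j(\nu)=(-1)^{r_j(\nu)}2^{j-1}\nu+(-1)^{r_j(\nu)+1}\left[\frac{r_j(\nu)+1}{2}\right]$. Powers of positive semidefinite matrices are taken by functional calculus, with $A^0=I$. *)

theory Defs
  imports "HOL-Analysis.Analysis" "Jordan_Normal_Form.Schur_Decomposition"
begin

definition hs_norm :: "complex mat \<Rightarrow> real" where
  "hs_norm A = sqrt (\<Sum>i<dim_row A. \<Sum>j<dim_col A. (cmod (A $$ (i, j)))\<^sup>2)"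

(* The last condition uses the order on complex: 0 \<le> z says that z is real and nonnegative. *)
definition psd_mat :: "nat \<Rightarrow> complex mat \<Rightarrow> bool" where
  "psd_mat n A \<longleftrightarrow> A \<in> carrier_mat n n \<and> mat_adjoint A = A \<and>
     (\<forall>v\<in>carrier_vec n. 0 \<le> (A *\<^sub>v v) \<bullet>c v)"

definition unitary_mat :: "nat \<Rightarrow> complex mat \<Rightarrow> bool" where
  "unitary_mat n U \<longleftrightarrow> U \<in> carrier_mat n n \<and> mat_adjoint U * U = 1\<^sub>m n"

definition unitary_diag :: "nat \<Rightarrow> complex mat \<Rightarrow> (nat \<Rightarrow> real) \<Rightarrow> complex mat" where
  "unitary_diag n U d = U * mat_diag n (\<lambda>i. complex_of_real (d i)) * mat_adjoint U"

(* Functional calculus f(A) = U diag(f(d_1),...,f(d_n)) U* for Hermitian A = U diag(d_1,...,d_n) U*;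
   by mat_fun_unitary_diag below, the result does not depend on the chosen U and d. *)
definition mat_fun :: "(real \<Rightarrow> real) \<Rightarrow> complex mat \<Rightarrow> complex mat" where
  "mat_fun f A = (THE F. \<exists>U d. unitary_mat (dim_row A) U \<and> A = unitary_diag (dim_row A) U d \<and>
     F = unitary_diag (dim_row A) U (\<lambda>i. f (d i)))"

(* The case p = 0 is separate because 0 powr 0 = 0, whereas A^0 = I is intended. *)
definition mat_powr :: "complex mat \<Rightarrow> real \<Rightarrow> complex mat" where
  "mat_powr A p = mat_fun (\<lambda>t. if p = 0 then 1 else t powr p) A"

definition kseq :: "nat \<Rightarrow> real \<Rightarrow> int" where
  "kseq j \<nu> = \<lfloor>2 ^ (j - 1) * \<nu>\<rfloor>"

definition rseq :: "nat \<Rightarrow> real \<Rightarrow> int" where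
  "rseq j \<nu> = \<lfloor>2 ^ j * \<nu>\<rfloor>"

definition sseq :: "nat \<Rightarrow> real \<Rightarrow> real" where
  "sseq j \<nu> = (- 1) powi (rseq j \<nu>) * 2 ^ (j - 1) * \<nu>
     + (- 1) powi (rseq j \<nu> + 1) * of_int \<lfloor>(of_int (rseq j \<nu>) + 1) / (2::real)\<rfloor>"

lemma mat_adjoint_carrier: "U \<in> carrier_mat n m \<Longrightarrow> mat_adjoint U \<in> carrier_mat m n"
  by (auto simp: mat_adjoint_def)

lemma unitary_diag_unique:
  assumes U: "unitary_mat n U" and V: "unitary_mat n V"
    and eq: "unitary_diag n U d = unitary_diag n V e"
  shows "unitary_diag n U (\<lambda>i. f (d i)) = unitary_diag n V (\<lambda>i. f (e i))"
proof -
  define D where "D = (\<lambda>d::nat\<Rightarrow>real. mat_diag n (\<lambda>i. complex_of_real (d i)))"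
  define U' where "U' = mat_adjoint U"
  define V' where "V' = mat_adjoint V"
  have c: "U \<in> carrier_mat n n" "V \<in> carrier_mat n n"
    using U V by (auto simp: unitary_mat_def)
  have c': "U' \<in> carrier_mat n n" "V' \<in> carrier_mat n n"
    using c mat_adjoint_carrier by (auto simp: U'_def V'_def)
  have DC: "D g \<in> carrier_mat n n" for g by (simp add: D_def)
  have u1: "U' * U = 1\<^sub>m n" "V' * V = 1\<^sub>m n"
    using U V by (auto simp: unitary_mat_def U'_def V'_def)
  have u2: "U * U' = 1\<^sub>m n" "V * V' = 1\<^sub>m n"
    using u1 c c' mat_mult_left_right_inverse by blast+
  define W where "W = V' * U"
  have W: "W \<in> carrier_mat n n" using c c' by (simp add: W_def)
  have VW: "V * W = U"
    using c c' u2 by (simp add: W_def flip: assoc_mult_mat[of V n n V' n U n])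
  have WU: "W * U' = V'"
    using c c' u2 by (simp add: W_def assoc_mult_mat[of V' n n U n U' n])
  have eq': "U * D d * U' = V * D e * V'"
    using eq by (simp add: unitary_diag_def D_def U'_def V'_def)
  have "W * D d = V' * (U * D d * U') * U"
    using c c' DC[of d] u1 W by (simp add: W_def assoc_mult_mat[of _ n n _ n _ n])
  also have "\<dots> = V' * (V * D e * V') * U" by (simp add: eq')
  also have "\<dots> = (V' * V) * D e * (V' * U)"
    using c c' DC[of e] by (simp add: assoc_mult_mat[of _ n n _ n _ n])
  also have "\<dots> = D e * W" using u1 DC[of e] by (simp add: W_def)
  finally have comm: "W * D d = D e * W" .
  have ent: "W $$ (i, j) * complex_of_real (d j) = complex_of_real (e i) * W $$ (i, j)"
    if "i < n" "j < n" for i j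
    using arg_cong[OF comm, of "\<lambda>M. M $$ (i, j)"] that W
    by (simp add: D_def mat_diag_mult_right[of _ n] mat_diag_mult_left[of _ n n])
  have "W $$ (i, j) * complex_of_real (f (d j)) = complex_of_real (f (e i)) * W $$ (i, j)"
    if "i < n" "j < n" for i j
    using ent[OF that] by (cases "W $$ (i, j) = 0") auto
  then have commf: "W * D (\<lambda>i. f (d i)) = D (\<lambda>i. f (e i)) * W"
    using W by (auto simp: D_def mat_diag_mult_right[of _ n] mat_diag_mult_left[of _ n n])
  have "U * D (\<lambda>i. f (d i)) * U' = V * (W * D (\<lambda>i. f (d i))) * U'"
    using c DC[of "\<lambda>i. f (d i)"] W by (simp add: VW flip: assoc_mult_mat[of V n n W n _ n])
  also have "\<dots> = V * D (\<lambda>i. f (e i)) * (W * U')"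
    unfolding commf using c c' DC[of "\<lambda>i. f (e i)"] W by (simp add: assoc_mult_mat[of _ n n _ n _ n])
  finally show ?thesis
    unfolding WU by (simp add: unitary_diag_def D_def U'_def V'_def)
qed

lemma mat_fun_unitary_diag:
  assumes "unitary_mat n U"
  shows "mat_fun f (unitary_diag n U d) = unitary_diag n U (\<lambda>i. f (d i))"
proof -
  have "dim_row (unitary_diag n U d) = n"
    using assms by (auto simp: unitary_diag_def unitary_mat_def)
  then show ?thesis
    unfolding mat_fun_def using assms
    by (auto intro!: the_equality) (metis unitary_diag_unique)
qed

end

theory Submission
  imports Defs "Jordan_Normal_Form.Spectral_Radius"
begin

text \<open>
  Diagonalise \<open>A = U diag(a) U*\<close> and \<open>B = V diag(b) V*\<close>. Every matrix under a norm is then of the form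
  \<open>U (F i j * Y i j) V*\<close> with \<open>Y = U* X V\<close>, so by unitary invariance of the Hilbert-Schmidt norm the
  claim reduces to a scalar inequality for each pair \<open>(a i, b j)\<close>. After expanding the first square it
  splits into two refined Young inequalities for the pairs \<open>(a^2, a b)\<close> and \<open>(b^2, a b)\<close> with weight
  \<open>x = 2 \<nu>\<close>. For these consider the convex function \<open>g t = a^(2 - t) * b^t\<close> and its piecewise
  linear interpolants on the dyadic grids of mesh \<open>2^(-j)\<close>. Halving the mesh lowers the interpolant at
  \<open>x\<close> by \<open>s_j x\<close> times a second difference of \<open>g\<close>, which is a perfect square, and by convexity the
  last interpolant still dominates \<open>g x\<close>. The case \<open>\<nu> \<ge> 1/2\<close> follows by exchanging \<open>\<nu>\<close> and \<open>1 - \<nu>\<close>.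
\<close>

subsection \<open>The scalar inequality\<close>

text \<open>The exponent 0 is split off because \<open>0 powr 0 = 0\<close>. This is exactly the
  function that \<open>mat_powr\<close> applies to the eigenvalues.\<close>

definition rpow :: "real \<Rightarrow> real \<Rightarrow> real" where
  "rpow p t = (if p = 0 then 1 else t powr p)"

lemma rpow_nonneg [simp]: "0 \<le> rpow p t"
  by (simp add: rpow_def)

lemma rpow_0 [simp]: "rpow 0 t = 1"
  by (simp add: rpow_def)

lemma rpow_1 [simp]: "0 \<le> t \<Longrightarrow> rpow 1 t = t"
  by (simp add: rpow_def)

text \<open>The signs matter at \<open>t = 0\<close>: with opposite nonzero exponents the left side
  would be 1 and the right side 0. For nonnegative exponents the sum vanishes only if both
  do.\<close>

lemma rpow_add:
  assumes "0 \<le> p" "0 \<le> q"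
  shows "rpow (p + q) t = rpow p t * rpow q t"
  using assms by (auto simp: rpow_def powr_add)

lemma rpow_double:
  assumes "0 \<le> p"
  shows "rpow (2 * p) t = (rpow p t)\<^sup>2"
  using rpow_add[OF assms assms] by (simp add: power2_eq_square)

lemma rpow_2 [simp]: "0 \<le> t \<Longrightarrow> rpow 2 t = t\<^sup>2"
  using rpow_double[of 1 t] by simp

section \<open>Piecewise linear interpolation on dyadic grids\<close>

definition dyadic_interp :: "(real \<Rightarrow> real) \<Rightarrow> nat \<Rightarrow> real \<Rightarrow> real" where
  "dyadic_interp g j x =
     (1 - frac (2 ^ j * x)) * g (\<lfloor>2 ^ j * x\<rfloor> / 2 ^ j) + frac (2 ^ j * x) * g ((\<lfloor>2 ^ j * x\<rfloor> + 1) / 2 ^ j)"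

text \<open>The parity of \<open>rseq (Suc j) x\<close> tells which half of its unit cell contains
  \<open>2 ^ j * x\<close>. The signs in \<open>sseq\<close> then select the distance to the left or
  to the right integer, so \<open>sseq\<close> is the tent function giving the distance to the
  nearest integer.\<close>

lemma sseq_Suc:
  "sseq (Suc j) x = min (frac (2 ^ j * x)) (1 - frac (2 ^ j * x))"
proof -
  define y where "y = 2 ^ j * x"
  define k where "k = \<lfloor>y\<rfloor>"
  have s: "sseq (Suc j) x = (- 1) powi \<lfloor>2 * y\<rfloor> * y
      + (- 1) powi (\<lfloor>2 * y\<rfloor> + 1) * of_int \<lfloor>(of_int \<lfloor>2 * y\<rfloor> + 1) / (2::real)\<rfloor>"
    by (simp add: sseq_def rseq_def y_def mult.assoc)
  have k: "k \<le> y" "y < k + 1" by (simp_all add: k_def)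
  show ?thesis
  proof (cases "y < k + 1/2")
    case True
    then have "\<lfloor>2 * y\<rfloor> = 2 * k" using k by (intro floor_unique) auto
    moreover have "\<lfloor>(of_int (2 * k) + 1) / (2::real)\<rfloor> = k" by (intro floor_unique) auto
    ultimately show ?thesis using True k
      by (simp add: s frac_def power_int_minus_left flip: y_def k_def)
  next
    case False
    then have "\<lfloor>2 * y\<rfloor> = 2 * k + 1" using k by (intro floor_unique) auto
    moreover have "\<lfloor>(of_int (2 * k + 1) + 1) / (2::real)\<rfloor> = k + 1" by (intro floor_unique) auto
    ultimately show ?thesis using False k
      by (simp add: s frac_def power_int_minus_left flip: y_def k_def)
  qed
qed

text \<open>Refinement only inserts the midpoint of the cell. Two successive interpolants agree at
  both ends of the cell and are linear on each half, so their difference is a multiple of the tent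
  \<open>sseq\<close>. At the midpoint the tent is 1/2 and the difference is half the second
  difference of \<open>g\<close>.\<close>

lemma dyadic_interp_Suc:
  "dyadic_interp g j x - dyadic_interp g (Suc j) x =
     sseq (Suc j) x * (g (kseq (Suc j) x / 2 ^ j) + g ((kseq (Suc j) x + 1) / 2 ^ j)
       - 2 * g ((2 * kseq (Suc j) x + 1) / 2 ^ Suc j))"
proof -
  define y where "y = 2 ^ j * x"
  define k where "k = \<lfloor>y\<rfloor>"
  \<comment> \<open>Both interpolants are read on the finer grid, where the coarse cell has the
    nodes \<open>2 * k\<close>, \<open>2 * k + 1\<close> and \<open>2 * k + 2\<close>.\<close>
  define G where "G i = g (i / 2 ^ Suc j)" for i :: real
  have k: "k \<le> y" "y < k + 1" by (simp_all add: k_def)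
  have G: "g (i / 2 ^ j) = G (2 * i)" for i by (simp add: G_def)
  have y': "2 ^ Suc j * x = 2 * y" by (simp add: y_def)
  have *: "dyadic_interp g j x = (1 - (y - k)) * G (2 * k) + (y - k) * G (2 * k + 2)"
    by (simp add: dyadic_interp_def frac_def G distrib_left flip: y_def k_def)
  have **: "dyadic_interp g (Suc j) x =
     (1 - (2 * y - \<lfloor>2 * y\<rfloor>)) * G \<lfloor>2 * y\<rfloor> + (2 * y - \<lfloor>2 * y\<rfloor>) * G (\<lfloor>2 * y\<rfloor> + 1)"
    unfolding dyadic_interp_def y' by (simp add: frac_def G_def)
  have kk: "kseq (Suc j) x = k" by (simp add: kseq_def k_def y_def)
  have main: "dyadic_interp g j x - dyadic_interp g (Suc j) x =
     min (y - k) (1 - (y - k)) * (G (2 * k) + G (2 * k + 2) - 2 * G (2 * k + 1))"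
  proof (cases "y < k + 1/2")
    case True
    then have "\<lfloor>2 * y\<rfloor> = 2 * k" using k by (intro floor_unique) auto
    then show ?thesis using True k unfolding * ** by (simp add: algebra_simps)
  next
    case False
    then have "\<lfloor>2 * y\<rfloor> = 2 * k + 1" using k by (intro floor_unique) auto
    then show ?thesis using False k unfolding * ** by (simp add: algebra_simps)
  qed
  have "G (2 * k + 2) = g ((k + 1) / 2 ^ j)" "G (2 * k) = g (k / 2 ^ j)"
    "G (2 * k + 1) = g ((2 * k + 1) / 2 ^ Suc j)"
    using G[of "k + 1"] G[of k] by (simp_all add: algebra_simps) (simp add: G_def algebra_simps)
  with main show ?thesis
    unfolding kk sseq_Suc by (simp add: frac_def flip: y_def k_def)
qed

text \<open>At \<open>x = 1\<close> the floor selects the cell from 1 to 2, but its right node then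
  has weight 0, so the chord formula survives.\<close>

lemma dyadic_interp_0:
  assumes "0 \<le> x" "x \<le> 1"
  shows "dyadic_interp g 0 x = (1 - x) * g 0 + x * g 1"
proof (cases "x = 1")
  case False
  then have "\<lfloor>x\<rfloor> = 0" using assms by (intro floor_unique) auto
  then show ?thesis by (simp add: dyadic_interp_def frac_def)
qed (simp add: dyadic_interp_def)

text \<open>For positive \<open>a\<close> and \<open>b\<close> the function \<open>g\<close> is the
  exponential of an affine function, and the claim is the weighted AM-GM inequality. If
  \<open>a\<close> or \<open>b\<close> is 0, then \<open>g\<close> vanishes strictly between 0 and 2
  and can only jump upwards at an end.\<close>

lemma rpow_interpolation_convex:
  assumes "0 \<le> a" "0 \<le> b" and u: "0 \<le> u" "u \<le> 2" and v: "0 \<le> v" "v \<le> 2"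
    and t: "0 \<le> t" "t < 1"
  defines "g \<equiv> \<lambda>s. rpow (2 - s) a * rpow s b"
  shows "g ((1 - t) * u + t * v) \<le> (1 - t) * g u + t * g v"
\<comment> \<open>Outside these trivial cases the intermediate point lies strictly between 0 and 2,
  so neither of its exponents is 0.\<close>
proof (cases "t = 0 \<or> u = v")
  case True
  then show ?thesis by (auto simp: algebra_simps)
next
  case False
  let ?w = "(1 - t) * u + t * v"
  have t': "0 < t" using False t by auto
  have nonneg: "0 \<le> (1 - t) * g u + t * g v" using t by (simp add: g_def)
  have w0: "0 < ?w"
  proof (cases "u = 0")
    case True then show ?thesis using False v t' by simp
  next
    case False then show ?thesis using u v t t' by (simp add: add_pos_nonneg)
  qed
  have "0 < (1 - t) * (2 - u) + t * (2 - v)"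
  proof (cases "u = 2")
    case True then show ?thesis using False v t' by simp
  next
    case False then show ?thesis using u v t t' by (simp add: add_pos_nonneg)
  qed
  then have w2: "?w < 2" by (simp add: algebra_simps)
  show ?thesis
  proof (cases "a = 0 \<or> b = 0")
    case True
    then have "g ?w = 0" using w0 w2 by (auto simp: g_def rpow_def)
    then show ?thesis using nonneg by simp
  next
    case False
    then have ab: "0 < a" "0 < b" using assms by auto
    then have g: "g s = exp ((2 - s) * ln a + s * ln b)" for s
      by (auto simp: g_def rpow_def powr_def exp_add)
    have "(2 - ?w) * ln a + ?w * ln b
        = (1 - t) * ((2 - u) * ln a + u * ln b) + t * ((2 - v) * ln a + v * ln b)"
      by (simp add: algebra_simps)
    then have "g ?w = g u powr (1 - t) * g v powr t"
      unfolding g by (simp add: powr_def flip: exp_add)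
    also have "\<dots> \<le> (1 - t) * g u + t * g v"
      using ab t by (intro Youngs_inequality_0) (auto simp: g)
    finally show ?thesis .
  qed
qed

text \<open>The sum telescopes to the drop from the chord of \<open>g\<close> over [0, 1] to its
  interpolant of level \<open>N\<close>. The chord has the end values \<open>g 0 = a^2\<close> and
  \<open>g 1 = a * b\<close>, which gives the right side.\<close>

lemma refined_young:
  assumes ab: "0 \<le> a" "0 \<le> b" and x: "0 \<le> x" "x \<le> 1"
  shows "rpow (2 - x) a * rpow x b
     + (\<Sum>j=1..N. sseq j x * (rpow (1 - kseq j x / 2 ^ j) a * rpow (kseq j x / 2 ^ j) b
         - rpow (1 - (kseq j x + 1) / 2 ^ j) a * rpow ((kseq j x + 1) / 2 ^ j) b)\<^sup>2)
     \<le> (1 - x) * a\<^sup>2 + x * (a * b)" (is "?L + sum ?S _ \<le> ?R")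
proof -
  define g where "g s = rpow (2 - s) a * rpow s b" for s
  \<comment> \<open>At \<open>x = 1\<close> the right node of the cell lies beyond 1. The bound
    keeps it within [0, 2], where both exponents in \<open>g\<close> are nonnegative.\<close>
  have kb: "0 \<le> \<lfloor>2 ^ j * x\<rfloor>" "real_of_int \<lfloor>2 ^ j * x\<rfloor> + 1 \<le> 2 * 2 ^ j" for j
  proof -
    show "0 \<le> \<lfloor>2 ^ j * x\<rfloor>" using x by simp
    have "\<lfloor>2 ^ j * x\<rfloor> \<le> 2 ^ j * x" by simp
    also have "\<dots> \<le> 2 ^ j * 1" using x by (intro mult_left_mono) auto
    finally show "real_of_int \<lfloor>2 ^ j * x\<rfloor> + 1 \<le> 2 * 2 ^ j"
      using one_le_power[of "2::real" j] by linarith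
  qed
  have step: "?S (Suc j) = dyadic_interp g j x - dyadic_interp g (Suc j) x" for j
  proof -
    define k where "k = real_of_int (kseq (Suc j) x)"
    have k: "0 \<le> k" "k + 1 \<le> 2 * 2 ^ j" using kb[of j] by (auto simp: k_def kseq_def)
    \<comment> \<open>Half of each coarse node: \<open>2 * p\<close> and \<open>2 * q\<close> are
      the ends of the cell and \<open>p + q\<close> is its midpoint. Thus \<open>g\<close> is a
      square at each end and the product of the two roots at the midpoint, which makes the second
      difference a perfect square.\<close>
    define p q where "p = k / 2 ^ Suc j" and "q = (k + 1) / 2 ^ Suc j"
    have pq: "0 \<le> p" "p \<le> 1" "0 \<le> q" "q \<le> 1" using k by (auto simp: p_def q_def field_simps)
    have "g (2 * p) = (rpow (1 - p) a * rpow p b)\<^sup>2"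
      using pq rpow_double[of "1 - p" a] rpow_double[of p b]
      by (simp add: g_def power_mult_distrib)
    moreover have "g (2 * q) = (rpow (1 - q) a * rpow q b)\<^sup>2"
      using pq rpow_double[of "1 - q" a] rpow_double[of q b]
      by (simp add: g_def power_mult_distrib)
    moreover have "g (p + q) = (rpow (1 - p) a * rpow p b) * (rpow (1 - q) a * rpow q b)"
      using pq rpow_add[of "1 - p" "1 - q" a] rpow_add[of p q b]
      by (simp add: g_def algebra_simps)
    ultimately have "g (2 * p) + g (2 * q) - 2 * g (p + q)
        = (rpow (1 - p) a * rpow p b - rpow (1 - q) a * rpow q b)\<^sup>2"
      by (simp add: power2_diff)
    moreover have "2 * p = k / 2 ^ j" "2 * q = (k + 1) / 2 ^ j" "p + q = (2 * k + 1) / 2 ^ Suc j"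
      by (simp_all add: p_def q_def field_simps)
    ultimately show ?thesis
      unfolding dyadic_interp_Suc by (simp add: p_def q_def flip: k_def)
  qed
  have tele: "sum ?S {1..N} = dyadic_interp g 0 x - dyadic_interp g N x"
  proof (induction N)
    case (Suc N)
    then show ?case using step[of N] by simp
  qed simp
  have "?L \<le> dyadic_interp g N x"
  proof -
    define k where "k = real_of_int \<lfloor>2 ^ N * x\<rfloor>"
    have k: "0 \<le> k" "k + 1 \<le> 2 * 2 ^ N" using kb[of N] by (auto simp: k_def)
    define t where "t = frac (2 ^ N * x)"
    have t: "0 \<le> t" "t < 1" by (simp_all add: t_def frac_lt_1)
    have "(1 - t) * (k / 2 ^ N) + t * ((k + 1) / 2 ^ N) = (k + t) / 2 ^ N"
      by (simp add: field_simps)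
    also have "\<dots> = x" by (simp add: k_def t_def frac_def)
    finally have x_eq: "(1 - t) * (k / 2 ^ N) + t * ((k + 1) / 2 ^ N) = x" .
    have "?L \<le> (1 - t) * g (k / 2 ^ N) + t * g ((k + 1) / 2 ^ N)"
      using rpow_interpolation_convex[OF ab, of "k / 2 ^ N" "(k + 1) / 2 ^ N" t] k t
      unfolding x_eq g_def by (simp add: pos_divide_le_eq)
    then show ?thesis by (simp add: dyadic_interp_def t_def k_def)
  qed
  moreover have "dyadic_interp g 0 x = ?R"
    using ab by (simp add: dyadic_interp_0[OF x] g_def power2_eq_square)
  ultimately show ?thesis using tele by simp
qed

text \<open>The cross term of the first square is \<open>2 * (a * b)\<close>, because the exponents
  of each base add up to 1. The two remaining terms are the leading terms of
  \<open>refined_young\<close> for \<open>(a, b)\<close> and \<open>(b, a)\<close> at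
  \<open>2 * \<nu>\<close>, which is at most 1.\<close>

lemma refined_heinz:
  assumes ab: "0 \<le> a" "0 \<le> b" and \<nu>: "0 \<le> \<nu>" "\<nu> \<le> 1/2"
  shows "(rpow \<nu> a * rpow (1 - \<nu>) b + rpow (1 - \<nu>) a * rpow \<nu> b)\<^sup>2 + 2 * \<nu> * (a - b)\<^sup>2
     + (\<Sum>j=1..N. sseq j (2 * \<nu>) *
         (rpow (1 - kseq j (2 * \<nu>) / 2 ^ j) a * rpow (kseq j (2 * \<nu>) / 2 ^ j) b
         - rpow (1 - (kseq j (2 * \<nu>) + 1) / 2 ^ j) a * rpow ((kseq j (2 * \<nu>) + 1) / 2 ^ j) b)\<^sup>2)
     + (\<Sum>j=1..N. sseq j (2 * \<nu>) *
         (rpow (kseq j (2 * \<nu>) / 2 ^ j) a * rpow (1 - kseq j (2 * \<nu>) / 2 ^ j) b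
         - rpow ((kseq j (2 * \<nu>) + 1) / 2 ^ j) a * rpow (1 - (kseq j (2 * \<nu>) + 1) / 2 ^ j) b)\<^sup>2)
     \<le> (a + b)\<^sup>2"
proof -
  have n: "0 \<le> 2 * \<nu>" "2 * \<nu> \<le> 1" using \<nu> by auto
  have "rpow (2 - 2 * \<nu>) t = (rpow (1 - \<nu>) t)\<^sup>2" "rpow (2 * \<nu>) t = (rpow \<nu> t)\<^sup>2" for t
    using rpow_double[of "1 - \<nu>" t] rpow_double[of \<nu> t] \<nu> by auto
  note sq = this
  have geo: "rpow \<nu> t * rpow (1 - \<nu>) t = t" if "0 \<le> t" for t
    using rpow_add[of \<nu> "1 - \<nu>" t] \<nu> that by simp
  have "rpow \<nu> a * rpow (1 - \<nu>) b * (rpow (1 - \<nu>) a * rpow \<nu> b)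
      = (rpow \<nu> a * rpow (1 - \<nu>) a) * (rpow \<nu> b * rpow (1 - \<nu>) b)"
    by (simp only: mult_ac)
  also have "\<dots> = a * b"
    using geo ab by simp
  finally have "(rpow \<nu> a * rpow (1 - \<nu>) b + rpow (1 - \<nu>) a * rpow \<nu> b)\<^sup>2
      = rpow (2 * \<nu>) a * rpow (2 - 2 * \<nu>) b + rpow (2 - 2 * \<nu>) a * rpow (2 * \<nu>) b + 2 * (a * b)"
    by (simp add: sq power2_sum power_mult_distrib)
  \<comment> \<open>The two Young bounds, the cross term and the correction
    \<open>2 * \<nu> * (a - b)^2\<close> add up to exactly the right side.\<close>
  moreover have "2 * \<nu> * (a - b)\<^sup>2 + ((1 - 2 * \<nu>) * a\<^sup>2 + 2 * \<nu> * (a * b))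
      + ((1 - 2 * \<nu>) * b\<^sup>2 + 2 * \<nu> * (b * a)) + 2 * (a * b) = (a + b)\<^sup>2"
    by (simp add: power2_eq_square algebra_simps)
  ultimately show ?thesis
    using refined_young[OF ab n, of N] refined_young[OF ab(2,1) n, of N]
    by (simp only: mult.commute[of "rpow _ b" "rpow _ a"])
qed

subsection \<open>Unitary diagonalisation of Hermitian matrices\<close>

lemma mat_adjoint_dims [simp]:
  "dim_row (mat_adjoint A) = dim_col A" "dim_col (mat_adjoint A) = dim_row A"
  by (simp_all add: mat_adjoint_def)

lemma mat_adjoint_index [simp]:
  fixes A :: "complex mat"
  assumes "i < dim_col A" "j < dim_row A"
  shows "mat_adjoint A $$ (i, j) = cnj (A $$ (j, i))"
  using assms by (simp add: mat_adjoint_def mat_of_rows_def)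

lemma mat_adjoint_adjoint [simp]: "mat_adjoint (mat_adjoint A) = (A :: complex mat)"
  by (rule eq_matI) auto

lemma mat_adjoint_mult:
  fixes A B :: "complex mat"
  assumes "A \<in> carrier_mat n m" "B \<in> carrier_mat m k"
  shows "mat_adjoint (A * B) = mat_adjoint B * mat_adjoint A"
  by (rule eq_matI) (use assms in \<open>auto simp: scalar_prod_def mult.commute intro!: sum.cong\<close>)

lemma unitary_mat_carrier:
  assumes "unitary_mat n U"
  shows "U \<in> carrier_mat n n" "mat_adjoint U \<in> carrier_mat n n"
  using assms by (auto simp: unitary_mat_def mat_adjoint_carrier)

lemma unitary_mat_inverse:
  assumes "unitary_mat n U"
  shows "mat_adjoint U * U = 1\<^sub>m n" "U * mat_adjoint U = 1\<^sub>m n"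
  using assms unitary_mat_carrier[OF assms] mat_mult_left_right_inverse
  by (auto simp: unitary_mat_def)

lemma unitary_mat_mult:
  assumes U: "unitary_mat n U" and V: "unitary_mat n V"
  shows "unitary_mat n (U * V)"
proof -
  note c = unitary_mat_carrier[OF U] unitary_mat_carrier[OF V]
  have "mat_adjoint (U * V) * (U * V) = mat_adjoint V * (mat_adjoint U * U) * V"
    using c by (simp add: mat_adjoint_mult[of _ n n _ n] assoc_mult_mat[of _ n n _ n _ n])
  then show ?thesis
    using c by (simp add: unitary_mat_def unitary_mat_inverse[OF U] unitary_mat_inverse[OF V])
qed

lemma unitary_diag_conj:
  assumes U: "unitary_mat n U" and V: "unitary_mat n V"
  shows "U * unitary_diag n V d * mat_adjoint U = unitary_diag n (U * V) d"
proof -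
  note c = unitary_mat_carrier[OF U] unitary_mat_carrier[OF V]
  define D where "D = mat_diag n (\<lambda>i. complex_of_real (d i))"
  have "D \<in> carrier_mat n n" by (simp add: D_def)
  with c show ?thesis
    by (simp add: unitary_diag_def mat_adjoint_mult[of _ n n _ n] assoc_mult_mat[of _ n n _ n _ n] flip: D_def)
qed

lemma complex_eigenvector_exists:
  fixes A :: "complex mat"
  assumes A: "A \<in> carrier_mat n n" and n: "n \<noteq> 0"
  obtains v e where "v \<in> carrier_vec n" "v \<noteq> 0\<^sub>v n" "A *\<^sub>v v = e \<cdot>\<^sub>v v"
proof -
  obtain e where "e \<in> spectrum A" using spectrum_non_empty[OF A] n by auto
  then show ?thesis
    using that A by (auto simp: spectrum_def eigenvalue_def eigenvector_def)
qed

text \<open>Complete \<open>v\<close> to a basis, orthogonalise it with \<open>v\<close> kept first,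
  and normalise the columns. The normalisation is why the first column is only a multiple of
  \<open>v\<close>.\<close>

lemma unitary_completion:
  fixes v :: "complex vec"
  assumes v: "v \<in> carrier_vec n" "v \<noteq> 0\<^sub>v n"
  obtains W c where "unitary_mat n W" "col W 0 = c \<cdot>\<^sub>v v"
proof -
  interpret cof_vec_space n "TYPE(complex)" .
  have n: "0 < n" using v by (cases n) auto
  define b where "b = basis_completion v"
  note bc = basis_completion[OF v, folded b_def]
  obtain vs where b: "b = v # vs" using bc(6,7) n by (cases b) auto
  define ws where "ws = gram_schmidt n b"
  have ws: "corthogonal ws" "set ws \<subseteq> carrier_vec n" "length ws = n"
    using gram_schmidt_result[OF bc(2,4,5) ws_def] bc(6) by auto
  have "hd ws = v" using gram_schmidt_hd[OF v(1), of vs] by (simp add: ws_def b)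
  then have ws0: "ws ! 0 = v" using ws(3) n by (cases ws) auto
  have wsc: "ws ! i \<in> carrier_vec n" if "i < n" for i using ws that by auto
  define l where "l i = Re (ws ! i \<bullet>c ws ! i)" for i
  have l: "ws ! i \<bullet>c ws ! i = complex_of_real (l i)" "0 < l i" if "i < n" for i
  proof -
    have "ws ! i \<bullet>c ws ! i \<ge> 0" by (rule conjugate_square_ge_0_vec)
    \<comment> \<open>\<open>corthogonal\<close> also says that no vector has zero product with
      itself, so the normalising factors are well defined.\<close>
    moreover have "ws ! i \<bullet>c ws ! i \<noteq> 0" using corthogonalD[OF ws(1), of i i] ws(3) that by auto
    ultimately show "ws ! i \<bullet>c ws ! i = complex_of_real (l i)" "0 < l i"
      by (auto simp: l_def complex_eq_iff less_eq_complex_def less_le)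
  qed
  define W where "W = Matrix.mat n n (\<lambda>(i, j). (1 / complex_of_real (sqrt (l j))) * (vec_index (ws ! j) i))"
  have W: "W \<in> carrier_mat n n" by (simp add: W_def)
  have "mat_adjoint W * W = 1\<^sub>m n"
  proof (rule eq_matI)
    fix i j assume "i < dim_row (1\<^sub>m n)" "j < dim_col (1\<^sub>m n)"
    then have ij: "i < n" "j < n" by auto
    have "(mat_adjoint W * W) $$ (i, j) = (\<Sum>k<n. cnj (W $$ (k, i)) * W $$ (k, j))"
      using W ij by (auto simp: scalar_prod_def lessThan_atLeast0)
    also have "\<dots> = 1 / complex_of_real (sqrt (l i) * sqrt (l j)) * (ws ! j \<bullet>c ws ! i)"
      using ij wsc[OF ij(1)] by (auto simp: W_def scalar_prod_def lessThan_atLeast0 sum_distrib_left intro!: sum.cong)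
    also have "\<dots> = 1\<^sub>m n $$ (i, j)"
    proof (cases "i = j")
      case True
      then show ?thesis using ij l[of i] by simp
    next
      case False
      then show ?thesis using ij corthogonalD[OF ws(1), of j i] ws(3) by simp
    qed
    finally show "(mat_adjoint W * W) $$ (i, j) = 1\<^sub>m n $$ (i, j)" .
  qed (use W in auto)
  then have "unitary_mat n W" using W by (simp add: unitary_mat_def)
  moreover have "col W 0 = (1 / complex_of_real (sqrt (l 0))) \<cdot>\<^sub>v v"
    using n v by (intro eq_vecI) (auto simp: W_def ws0)
  ultimately show ?thesis by (rule that)
qed

lemma mat_adjoint_four_block:
  fixes A B C D :: "complex mat"
  assumes "A \<in> carrier_mat n1 m1" "B \<in> carrier_mat n1 m2" "C \<in> carrier_mat n2 m1" "D \<in> carrier_mat n2 m2"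
  shows "mat_adjoint (four_block_mat A B C D)
    = four_block_mat (mat_adjoint A) (mat_adjoint C) (mat_adjoint B) (mat_adjoint D)"
  by (rule eq_matI) (use assms in \<open>auto simp: four_block_mat_def Let_def\<close>)

text \<open>Deflation: in an orthonormal basis that starts with an eigenvector, the first column is
  zero below the diagonal. By symmetry so is the rest of the first row, and the induction hypothesis
  handles the remaining block.\<close>

lemma hermitian_unitary_diag:
  fixes A :: "complex mat"
  assumes "A \<in> carrier_mat n n" "mat_adjoint A = A"
  shows "\<exists>U d. unitary_mat n U \<and> A = unitary_diag n U d"
  using assms
proof (induction n arbitrary: A)
  case 0
  then show ?case
    by (intro exI[of _ "1\<^sub>m 0"] exI) (auto simp: unitary_mat_def unitary_diag_def)
next
  case (Suc m A)
  let ?n = "Suc m"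
  note A = Suc.prems(1)
  obtain v e where v: "v \<in> carrier_vec ?n" "v \<noteq> 0\<^sub>v ?n" and ev: "A *\<^sub>v v = e \<cdot>\<^sub>v v"
    using complex_eigenvector_exists[OF A] by blast
  obtain W c where W: "unitary_mat ?n W" and col: "col W 0 = c \<cdot>\<^sub>v v"
    using unitary_completion[OF v] by blast
  note Wc = unitary_mat_carrier[OF W]
  define M where "M = mat_adjoint W * A * W"
  have M: "M \<in> carrier_mat ?n ?n" using A Wc by (simp add: M_def)
  have herm: "mat_adjoint M = M"
    using A Wc Suc.prems(2)
    by (simp add: M_def mat_adjoint_mult[of _ ?n ?n _ ?n] assoc_mult_mat[of _ ?n ?n _ ?n _ ?n])
  have "A *\<^sub>v col W 0 = e \<cdot>\<^sub>v col W 0"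
    using A v ev by (simp add: col mult_mat_vec smult_smult_assoc mult.commute)
  then have "col (A * W) 0 = e \<cdot>\<^sub>v col W 0" using col_mult2[OF A Wc(1)] by simp
  then have "col M 0 = mat_adjoint W *\<^sub>v (e \<cdot>\<^sub>v col W 0)"
    using A Wc by (simp add: M_def assoc_mult_mat[of _ ?n ?n _ ?n _ ?n] col_mult2[of _ ?n ?n _ ?n])
  also have "\<dots> = e \<cdot>\<^sub>v col (mat_adjoint W * W) 0"
    using Wc mult_mat_vec[OF Wc(2) col_carrier_vec[OF _ Wc(1)], of 0 e] col_mult2[OF Wc(2,1), of 0] by simp
  finally have col0: "col M 0 = e \<cdot>\<^sub>v unit_vec ?n 0" by (simp add: unitary_mat_inverse[OF W])
  have c0: "M $$ (i, 0) = (if i = 0 then e else 0)" if "i < ?n" for i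
    using arg_cong[OF col0, of "\<lambda>w. vec_index w i"] that M by auto
  have sym: "M $$ (i, j) = cnj (M $$ (j, i))" if "i < ?n" "j < ?n" for i j
    using arg_cong[OF herm, of "\<lambda>N. N $$ (i, j)"] that M by auto
  \<comment> \<open>A diagonal entry of a Hermitian matrix is real, so \<open>Re e\<close> can serve
    as the first entry of \<open>d'\<close>.\<close>
  have e: "complex_of_real (Re e) = e"
    using sym[of 0 0] c0[of 0] by (simp add: complex_eq_iff)
  define M' where "M' = Matrix.mat m m (\<lambda>(i, j). M $$ (Suc i, Suc j))"
  have M': "M' \<in> carrier_mat m m" by (simp add: M'_def)
  have "mat_adjoint M' = M'"
    by (rule eq_matI) (auto simp: M'_def sym[symmetric])
  then obtain U d where U: "unitary_mat m U" and Ud: "M' = unitary_diag m U d"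
    using Suc.IH[OF M'] by blast
  note Uc = unitary_mat_carrier[OF U]
  have one: "1\<^sub>m 1 \<in> carrier_mat 1 1" and zero1: "0\<^sub>m 1 m \<in> carrier_mat 1 m"
    and zero2: "0\<^sub>m m 1 \<in> carrier_mat m 1" for m
    by auto
  \<comment> \<open>Bordering \<open>U\<close> by a 1 extends the diagonalisation of the block
    \<open>M'\<close> to all of \<open>M\<close> and leaves the first basis vector fixed.\<close>
  define P where "P = four_block_mat (1\<^sub>m 1) (0\<^sub>m 1 m) (0\<^sub>m m 1) U"
  define d' where "d' i = (case i of 0 \<Rightarrow> Re e | Suc k \<Rightarrow> d k)" for i
  have Padj: "mat_adjoint P = four_block_mat (1\<^sub>m 1) (0\<^sub>m 1 m) (0\<^sub>m m 1) (mat_adjoint U)"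
  proof -
    have "mat_adjoint (1\<^sub>m 1) = (1\<^sub>m 1 :: complex mat)" "mat_adjoint (0\<^sub>m 1 m) = (0\<^sub>m m 1 :: complex mat)"
      "mat_adjoint (0\<^sub>m m 1) = (0\<^sub>m 1 m :: complex mat)"
      by (auto intro!: eq_matI)
    then show ?thesis
      unfolding P_def using mat_adjoint_four_block[OF one zero1 zero2 Uc(1)] by simp
  qed
  have P: "unitary_mat ?n P"
  proof -
    have "mat_adjoint P * P = four_block_mat (1\<^sub>m 1) (0\<^sub>m 1 m) (0\<^sub>m m 1) (1\<^sub>m m)"
      unfolding Padj unfolding P_def
      using mult_four_block_mat[OF one zero1 zero2 Uc(2) one zero1 zero2 Uc(1)] Uc
      by (simp add: unitary_mat_inverse[OF U])
    also have "\<dots> = 1\<^sub>m ?n" by (rule eq_matI) auto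
    finally show ?thesis
      using four_block_carrier_mat[OF one Uc(1)] by (simp add: unitary_mat_def P_def)
  qed
  note Pc = unitary_mat_carrier[OF P]
  define D where "D = mat_diag m (\<lambda>i. complex_of_real (d i))"
  define E where "E = Matrix.mat 1 1 (\<lambda>_. e)"
  have DE: "D \<in> carrier_mat m m" "E \<in> carrier_mat 1 1" by (auto simp: D_def E_def)
  have "mat_diag ?n (\<lambda>i. complex_of_real (d' i)) = four_block_mat E (0\<^sub>m 1 m) (0\<^sub>m m 1) D"
    using e by (intro eq_matI) (auto simp: mat_diag_def D_def E_def d'_def split: nat.splits)
  then have "unitary_diag ?n P d' = P * four_block_mat E (0\<^sub>m 1 m) (0\<^sub>m m 1) D * mat_adjoint P"
    by (simp add: unitary_diag_def)
  also have "P * four_block_mat E (0\<^sub>m 1 m) (0\<^sub>m m 1) D = four_block_mat E (0\<^sub>m 1 m) (0\<^sub>m m 1) (U * D)"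
    unfolding P_def using mult_four_block_mat[OF one zero1 zero2 Uc(1) DE(2) zero1 zero2 DE(1)] Uc DE
    by simp
  also have "\<dots> * mat_adjoint P = four_block_mat E (0\<^sub>m 1 m) (0\<^sub>m m 1) (U * D * mat_adjoint U)"
    unfolding Padj using mult_four_block_mat[OF DE(2) zero1 zero2 mult_carrier_mat[OF Uc(1) DE(1)]
        one zero1 zero2 Uc(2)] Uc DE
    by simp
  also have "U * D * mat_adjoint U = M'" by (simp add: Ud unitary_diag_def D_def)
  also have "four_block_mat E (0\<^sub>m 1 m) (0\<^sub>m m 1) M' = M"
  proof (rule eq_matI)
    fix i j assume "i < dim_row M" "j < dim_col M"
    then have ij: "i < ?n" "j < ?n" using M by auto
    have "M $$ (0, j) = (if j = 0 then e else 0)" 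
      using sym[of 0 j] c0[of j] sym[of 0 0] c0[of 0] ij by (cases "j = 0") auto
    then show "four_block_mat E (0\<^sub>m 1 m) (0\<^sub>m m 1) M' $$ (i, j) = M $$ (i, j)"
      using ij c0[of i] by (auto simp: E_def M'_def)
  qed (use M in \<open>auto simp: E_def M'_def\<close>)
  finally have MP: "M = unitary_diag ?n P d'" ..
  \<comment> \<open>Undoing the change of basis: \<open>W * P\<close> collects both unitary
    factors.\<close>
  have "A = (W * mat_adjoint W) * A * (W * mat_adjoint W)"
    using A by (simp add: unitary_mat_inverse[OF W])
  also have "\<dots> = W * M * mat_adjoint W"
    using A Wc by (simp add: M_def assoc_mult_mat[of _ ?n ?n _ ?n _ ?n])
  also have "\<dots> = unitary_diag ?n (W * P) d'"
    unfolding MP by (rule unitary_diag_conj[OF W P])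
  finally show ?case using unitary_mat_mult[OF W P] by blast
qed

text \<open>The columns of \<open>U\<close> are unit eigenvectors, so the quadratic form of
  \<open>A\<close> takes the value \<open>d i\<close> at column \<open>i\<close>.\<close>

lemma psd_unitary_diag:
  assumes "psd_mat n A"
  obtains U d where "unitary_mat n U" "A = unitary_diag n U d" "\<And>i. i < n \<Longrightarrow> 0 \<le> d i"
proof -
  obtain U d where U: "unitary_mat n U" and A: "A = unitary_diag n U d"
    using hermitian_unitary_diag[of A n] assms by (auto simp: psd_mat_def)
  note Uc = unitary_mat_carrier[OF U]
  have "0 \<le> d i" if i: "i < n" for i
  proof -
    define D where "D = mat_diag n (\<lambda>i. complex_of_real (d i))"
    have D: "D \<in> carrier_mat n n" by (simp add: D_def)
    have "A * U = U * D * (mat_adjoint U * U)"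
      using Uc D by (simp add: A unitary_diag_def assoc_mult_mat[of _ n n _ n _ n] flip: D_def)
    also have "\<dots> = U * D"
      using Uc D by (simp add: unitary_mat_inverse[OF U])
    finally have AU: "A * U = U * D" .
    have Ac: "A \<in> carrier_mat n n" using assms by (simp add: psd_mat_def)
    have "A *\<^sub>v col U i = col (A * U) i"
      by (rule col_mult2[OF Ac Uc(1) i, symmetric])
    also have "\<dots> = complex_of_real (d i) \<cdot>\<^sub>v col U i"
      unfolding AU using Uc i by (intro eq_vecI) (auto simp: D_def mat_diag_mult_right[of _ n])
    finally have "(A *\<^sub>v col U i) \<bullet>c col U i = complex_of_real (d i) * (col U i \<bullet>c col U i)"
      using Uc i by simp
    also have "col U i \<bullet>c col U i = (mat_adjoint U * U) $$ (i, i)"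
      using Uc i by (auto simp: scalar_prod_def mult.commute intro!: sum.cong)
    finally have "(A *\<^sub>v col U i) \<bullet>c col U i = complex_of_real (d i)"
      using i by (simp add: unitary_mat_inverse[OF U])
    moreover have "0 \<le> (A *\<^sub>v col U i) \<bullet>c col U i"
      using assms Uc i by (auto simp: psd_mat_def)
    ultimately show "0 \<le> d i" by (simp add: less_eq_complex_def)
  qed
  then show ?thesis using that U A by blast
qed

subsection \<open>Unitary invariance of the Hilbert-Schmidt norm\<close>

lemma hs_norm_sq: "(hs_norm M)\<^sup>2 = (\<Sum>i<dim_row M. \<Sum>j<dim_col M. (cmod (M $$ (i, j)))\<^sup>2)"
  by (simp add: hs_norm_def sum_nonneg)

lemma hs_norm_mat_adjoint [simp]: "hs_norm (mat_adjoint M) = hs_norm M"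
  unfolding hs_norm_def mat_adjoint_dims by (subst sum.swap) simp

text \<open>The norm is expressed as a trace of the Gram matrix, which does not change when
  \<open>M\<close> is multiplied on the left by a unitary matrix.\<close>

lemma hs_norm_sq_gram:
  "complex_of_real ((hs_norm M)\<^sup>2) = (\<Sum>j<dim_col M. (mat_adjoint M * M) $$ (j, j))"
proof -
  have "(hs_norm M)\<^sup>2 = (\<Sum>j<dim_col M. \<Sum>i<dim_row M. (cmod (M $$ (i, j)))\<^sup>2)"
    unfolding hs_norm_sq by (rule sum.swap)
  then show ?thesis
    by (simp add: scalar_prod_def lessThan_atLeast0 mult.commute complex_norm_square del: of_real_power)
qed

lemma hs_norm_unitary_left:
  assumes U: "unitary_mat n U" and M: "M \<in> carrier_mat n m"
  shows "hs_norm (U * M) = hs_norm M"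
proof -
  note Uc = unitary_mat_carrier[OF U]
  have "mat_adjoint (U * M) * (U * M) = mat_adjoint M * (mat_adjoint U * (U * M))"
    using Uc M mat_adjoint_carrier[OF M]
    by (simp add: mat_adjoint_mult[of _ n n _ m] assoc_mult_mat[of _ m n _ n _ m])
  also have "mat_adjoint U * (U * M) = M"
    using Uc M by (simp add: unitary_mat_inverse[OF U] flip: assoc_mult_mat[of _ n n _ n _ m])
  finally have "complex_of_real ((hs_norm (U * M))\<^sup>2) = complex_of_real ((hs_norm M)\<^sup>2)"
    using M by (simp add: hs_norm_sq_gram del: of_real_power)
  then have "(hs_norm (U * M))\<^sup>2 = (hs_norm M)\<^sup>2" by (simp only: of_real_eq_iff)
  then show ?thesis by (simp add: hs_norm_def sum_nonneg)
qed

text \<open>Adjoints preserve the norm and turn right multiplication into left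
  multiplication.\<close>

lemma hs_norm_unitary_right:
  assumes V: "unitary_mat n V" and M: "M \<in> carrier_mat m n"
  shows "hs_norm (M * mat_adjoint V) = hs_norm M"
proof -
  have "hs_norm (M * mat_adjoint V) = hs_norm (V * mat_adjoint M)"
    using mat_adjoint_mult[OF M unitary_mat_carrier(2)[OF V]] hs_norm_mat_adjoint[of "M * mat_adjoint V"]
    by simp
  also have "\<dots> = hs_norm M"
    using hs_norm_unitary_left[OF V mat_adjoint_carrier[OF M]] by simp
  finally show ?thesis .
qed

lemma hs_norm_unitary_conj:
  assumes "unitary_mat n U" "unitary_mat n V" "M \<in> carrier_mat n n"
  shows "hs_norm (U * M * mat_adjoint V) = hs_norm M"
  using assms unitary_mat_carrier[OF assms(1)]
  by (simp add: hs_norm_unitary_right[of n V _ n] hs_norm_unitary_left[of n U _ n])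

section \<open>Matrix powers and entrywise multipliers in the eigenbases\<close>

lemma mat_powr_unitary_diag:
  assumes "unitary_mat n U"
  shows "mat_powr (unitary_diag n U d) p = unitary_diag n U (\<lambda>i. rpow p (d i))"
  unfolding mat_powr_def by (simp add: mat_fun_unitary_diag[OF assms] rpow_def)

lemma mat_powr_carrier:
  assumes "psd_mat n A"
  shows "mat_powr A p \<in> carrier_mat n n"
proof -
  obtain U d where U: "unitary_mat n U" and A: "A = unitary_diag n U d"
    using psd_unitary_diag[OF assms] by blast
  show ?thesis
    unfolding A mat_powr_unitary_diag[OF U] unfolding unitary_diag_def
    using unitary_mat_carrier[OF U] by (intro mult_carrier_mat[of _ n n]) auto
qed

text \<open>The Schur (Hadamard) product of \<open>Y\<close> with a real array \<open>F\<close>,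
  carried back from the eigenbases. It is linear in \<open>F\<close> for fixed \<open>U\<close>,
  \<open>V\<close> and \<open>Y\<close>, so sums and differences of matrices become those of
  arrays.\<close>

definition schur_mult ::
  "nat \<Rightarrow> complex mat \<Rightarrow> complex mat \<Rightarrow> complex mat \<Rightarrow> (nat \<Rightarrow> nat \<Rightarrow> real) \<Rightarrow> complex mat" where
  "schur_mult n U V Y F =
     U * Matrix.mat n n (\<lambda>(i, j). complex_of_real (F i j) * Y $$ (i, j)) * mat_adjoint V"

lemma schur_mult_add:
  assumes "unitary_mat n U" "unitary_mat n V"
  shows "schur_mult n U V Y F + schur_mult n U V Y G = schur_mult n U V Y (\<lambda>i j. F i j + G i j)"
proof -
  let ?M = "\<lambda>F. Matrix.mat n n (\<lambda>(i, j). complex_of_real (F i j) * Y $$ (i, j))"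
  have "?M (\<lambda>i j. F i j + G i j) = ?M F + ?M G" by (rule eq_matI) (auto simp: algebra_simps)
  then show ?thesis
    using unitary_mat_carrier[OF assms(1)] unitary_mat_carrier[OF assms(2)]
    by (simp add: schur_mult_def mult_add_distrib_mat[of _ n n _ n] add_mult_distrib_mat[of _ n n _ _ n])
qed

lemma schur_mult_diff:
  assumes "unitary_mat n U" "unitary_mat n V"
  shows "schur_mult n U V Y F - schur_mult n U V Y G = schur_mult n U V Y (\<lambda>i j. F i j - G i j)"
proof -
  let ?M = "\<lambda>F. Matrix.mat n n (\<lambda>(i, j). complex_of_real (F i j) * Y $$ (i, j))"
  have "?M (\<lambda>i j. F i j - G i j) = ?M F - ?M G" by (rule eq_matI) (auto simp: algebra_simps)
  then show ?thesis
    using unitary_mat_carrier[OF assms(1)] unitary_mat_carrier[OF assms(2)]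
    by (simp add: schur_mult_def mult_minus_distrib_mat[of _ n n _ n] minus_mult_distrib_mat[of _ n n _ _ n])
qed

lemma hs_norm_schur_mult:
  assumes "unitary_mat n U" "unitary_mat n V"
  shows "(hs_norm (schur_mult n U V Y F))\<^sup>2 = (\<Sum>i<n. \<Sum>j<n. (F i j)\<^sup>2 * (cmod (Y $$ (i, j)))\<^sup>2)"
  by (simp add: schur_mult_def hs_norm_unitary_conj[OF assms] hs_norm_sq norm_mult power_mult_distrib)

text \<open>In the eigenbases the left factor scales the rows of
  \<open>mat_adjoint U * X * V\<close> and the right factor scales its columns.\<close>

lemma unitary_diag_mult_schur:
  assumes U: "unitary_mat n U" and V: "unitary_mat n V" and X: "X \<in> carrier_mat n n"
  shows "unitary_diag n U d * X * unitary_diag n V e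
    = schur_mult n U V (mat_adjoint U * X * V) (\<lambda>i j. d i * e j)"
proof -
  note c = unitary_mat_carrier[OF U] unitary_mat_carrier[OF V] X
  let ?Y = "mat_adjoint U * X * V"
  define D where "D = mat_diag n (\<lambda>i. complex_of_real (d i))"
  define E where "E = mat_diag n (\<lambda>i. complex_of_real (e i))"
  have DE: "D \<in> carrier_mat n n" "E \<in> carrier_mat n n" by (simp_all add: D_def E_def)
  have Y: "?Y \<in> carrier_mat n n" using c by simp
  have "D * ?Y * E = Matrix.mat n n (\<lambda>(i, j). complex_of_real (d i * e j) * ?Y $$ (i, j))"
    unfolding D_def E_def
    by (rule eq_matI) (use Y in \<open>auto simp: mat_diag_mult_left[OF Y] mat_diag_mult_right[of _ n]\<close>)
  moreover have "unitary_diag n U d * X * unitary_diag n V e = U * (D * ?Y * E) * mat_adjoint V"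
    using c DE by (simp add: unitary_diag_def assoc_mult_mat[of _ n n _ n _ n] flip: D_def E_def)
  ultimately show ?thesis by (simp add: schur_mult_def)
qed

text \<open>All matrices under the norms share the same \<open>U\<close>, \<open>V\<close> and
  \<open>Y\<close>. Each squared norm is thus a sum over \<open>(i, j)\<close> with the same
  nonnegative weights, and \<open>refined_heinz\<close> applies to each pair
  \<open>(a i, b j)\<close>.\<close>

lemma refined_heinz_hs_norm:
  fixes A B X :: "complex mat" and \<nu> :: real
  assumes psdA: "psd_mat n A" and psdB: "psd_mat n B" and X: "X \<in> carrier_mat n n"
    and \<nu>: "0 \<le> \<nu>" "\<nu> \<le> 1/2"
  shows "(hs_norm (mat_powr A \<nu> * X * mat_powr B (1 - \<nu>) + mat_powr A (1 - \<nu>) * X * mat_powr B \<nu>))\<^sup>2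
       + 2 * \<nu> * (hs_norm (A * X - X * B))\<^sup>2
       + (\<Sum>j=1..N. sseq j (2 * \<nu>) * (hs_norm
           (mat_powr A (1 - kseq j (2 * \<nu>) / 2 ^ j) * X * mat_powr B (kseq j (2 * \<nu>) / 2 ^ j)
            - mat_powr A (1 - (kseq j (2 * \<nu>) + 1) / 2 ^ j) * X
              * mat_powr B ((kseq j (2 * \<nu>) + 1) / 2 ^ j)))\<^sup>2)
       + (\<Sum>j=1..N. sseq j (2 * \<nu>) * (hs_norm
           (mat_powr A (kseq j (2 * \<nu>) / 2 ^ j) * X * mat_powr B (1 - kseq j (2 * \<nu>) / 2 ^ j)
            - mat_powr A ((kseq j (2 * \<nu>) + 1) / 2 ^ j) * X
              * mat_powr B (1 - (kseq j (2 * \<nu>) + 1) / 2 ^ j)))\<^sup>2)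
       \<le> (hs_norm (A * X + X * B))\<^sup>2"
proof -
  obtain U a where U: "unitary_mat n U" and A: "A = unitary_diag n U a" and a: "\<And>i. i < n \<Longrightarrow> 0 \<le> a i"
    using psd_unitary_diag[OF psdA] by blast
  obtain V b where V: "unitary_mat n V" and B: "B = unitary_diag n V b" and b: "\<And>i. i < n \<Longrightarrow> 0 \<le> b i"
    using psd_unitary_diag[OF psdB] by blast
  define Y where "Y = mat_adjoint U * X * V"
  let ?K = "schur_mult n U V Y"
  have powr: "mat_powr A p * X * mat_powr B q = ?K (\<lambda>i j. rpow p (a i) * rpow q (b j))" for p q
    unfolding A B Y_def mat_powr_unitary_diag[OF U] mat_powr_unitary_diag[OF V]
    by (rule unitary_diag_mult_schur[OF U V X])
  \<comment> \<open>The identity as a unitary diagonal form supplies the missing factor in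
    \<open>A * X\<close> and \<open>X * B\<close>.\<close>
  have one: "unitary_diag n W (\<lambda>_. 1) = 1\<^sub>m n" if "unitary_mat n W" for W
    using unitary_mat_carrier[OF that] unitary_mat_inverse[OF that] by (simp add: unitary_diag_def)
  have AX: "A * X = ?K (\<lambda>i j. a i)"
    using unitary_diag_mult_schur[OF U V X, of a "\<lambda>_. 1"] psdA X
    by (simp add: one[OF V] A psd_mat_def Y_def)
  have XB: "X * B = ?K (\<lambda>i j. b j)"
    using unitary_diag_mult_schur[OF U V X, of "\<lambda>_. 1" b] X
    by (simp add: one[OF U] B Y_def)
  \<comment> \<open>A monotone linear functional on real arrays: linearity gathers the whole left
    side into one array, and monotonicity leaves an entrywise inequality.\<close>
  define S where "S F = (\<Sum>i<n. \<Sum>j<n. F i j * (cmod (Y $$ (i, j)))\<^sup>2)" for F :: "nat \<Rightarrow> nat \<Rightarrow> real"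
  have S_add: "S F + S G = S (\<lambda>i j. F i j + G i j)" for F G
    by (simp add: S_def sum.distrib algebra_simps)
  have S_mult: "c * S F = S (\<lambda>i j. c * F i j)" for c F
    by (simp add: S_def sum_distrib_left mult.assoc)
  have S_sum: "(\<Sum>k\<in>I. S (F k)) = S (\<lambda>i j. \<Sum>k\<in>I. F k i j)" for F and I :: "nat set"
    by (induction I rule: infinite_finite_induct) (simp_all add: S_add, simp_all add: S_def)
  have S_mono: "S F \<le> S G" if "\<And>i j. i < n \<Longrightarrow> j < n \<Longrightarrow> F i j \<le> G i j" for F G
    unfolding S_def using that by (intro sum_mono mult_right_mono) auto
  have norm: "(hs_norm (?K F))\<^sup>2 = S (\<lambda>i j. (F i j)\<^sup>2)" for F
    by (simp add: hs_norm_schur_mult[OF U V] S_def)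
  show ?thesis
    unfolding powr AX XB schur_mult_add[OF U V] schur_mult_diff[OF U V] norm S_mult S_sum S_add
    by (rule S_mono, rule refined_heinz) (use a b \<nu> in auto)
qed

theorem theorem5p4:
  fixes n N :: nat and A B X :: "complex mat" and \<nu> :: real
  assumes "psd_mat n A" and "psd_mat n B" and "X \<in> carrier_mat n n" and "N \<ge> 1"
  shows
    "(0 \<le> \<nu> \<and> \<nu> \<le> 1/2 \<longrightarrow>
       (hs_norm (mat_powr A \<nu> * X * mat_powr B (1 - \<nu>) + mat_powr A (1 - \<nu>) * X * mat_powr B \<nu>))\<^sup>2
       + 2 * \<nu> * (hs_norm (A * X - X * B))\<^sup>2
       + (\<Sum>j=1..N. sseq j (2 * \<nu>) * (hs_norm
           (mat_powr A (1 - kseq j (2 * \<nu>) / 2 ^ j) * X * mat_powr B (kseq j (2 * \<nu>) / 2 ^ j)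
            - mat_powr A (1 - (kseq j (2 * \<nu>) + 1) / 2 ^ j) * X
              * mat_powr B ((kseq j (2 * \<nu>) + 1) / 2 ^ j)))\<^sup>2)
       + (\<Sum>j=1..N. sseq j (2 * \<nu>) * (hs_norm
           (mat_powr A (kseq j (2 * \<nu>) / 2 ^ j) * X * mat_powr B (1 - kseq j (2 * \<nu>) / 2 ^ j)
            - mat_powr A ((kseq j (2 * \<nu>) + 1) / 2 ^ j) * X
              * mat_powr B (1 - (kseq j (2 * \<nu>) + 1) / 2 ^ j)))\<^sup>2)
       \<le> (hs_norm (A * X + X * B))\<^sup>2)
   \<and> (1/2 \<le> \<nu> \<and> \<nu> \<le> 1 \<longrightarrow>
       (hs_norm (mat_powr A \<nu> * X * mat_powr B (1 - \<nu>) + mat_powr A (1 - \<nu>) * X * mat_powr B \<nu>))\<^sup>2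
       + 2 * (1 - \<nu>) * (hs_norm (A * X - X * B))\<^sup>2
       + (\<Sum>j=1..N. sseq j (2 - 2 * \<nu>) * (hs_norm
           (mat_powr A (1 - kseq j (2 - 2 * \<nu>) / 2 ^ j) * X * mat_powr B (kseq j (2 - 2 * \<nu>) / 2 ^ j)
            - mat_powr A (1 - (kseq j (2 - 2 * \<nu>) + 1) / 2 ^ j) * X
              * mat_powr B ((kseq j (2 - 2 * \<nu>) + 1) / 2 ^ j)))\<^sup>2)
       + (\<Sum>j=1..N. sseq j (2 - 2 * \<nu>) * (hs_norm
           (mat_powr A (kseq j (2 - 2 * \<nu>) / 2 ^ j) * X * mat_powr B (1 - kseq j (2 - 2 * \<nu>) / 2 ^ j)
            - mat_powr A ((kseq j (2 - 2 * \<nu>) + 1) / 2 ^ j) * X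
              * mat_powr B (1 - (kseq j (2 - 2 * \<nu>) + 1) / 2 ^ j)))\<^sup>2)
       \<le> (hs_norm (A * X + X * B))\<^sup>2)"
proof -
  have carr: "mat_powr A p * X * mat_powr B q \<in> carrier_mat n n" for p q
    using mat_powr_carrier[OF assms(1)] mat_powr_carrier[OF assms(2)] assms(3) by (intro mult_carrier_mat[of _ n n]) auto
  have "1 - (1 - \<nu>) = \<nu>" "sseq j (2 * (1 - \<nu>)) = sseq j (2 - 2 * \<nu>)"
    "kseq j (2 * (1 - \<nu>)) = kseq j (2 - 2 * \<nu>)" for j
    by (simp_all add: right_diff_distrib)
  \<comment> \<open>Replacing \<open>\<nu>\<close> by \<open>1 - \<nu>\<close> swaps the two
    summands in the first norm. Commuting them back requires the dimensions recorded in
    \<open>carr\<close>.\<close>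
  note reflected = refined_heinz_hs_norm[OF assms(1-3), of "1 - \<nu>" N, unfolded this
      comm_add_mat[OF carr[of "1 - \<nu>" \<nu>] carr[of \<nu> "1 - \<nu>"]]]
  show ?thesis
  proof (intro conjI impI, goal_cases)
    case 1
    then show ?case using refined_heinz_hs_norm[OF assms(1-3), of \<nu> N] by blast
  next
    case 2
    then have "0 \<le> 1 - \<nu>" "1 - \<nu> \<le> 1/2" by auto
    then show ?case by (rule reflected)
  qed
qed

end
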